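(* Let $(c_n)_{n\in\mathbb{N}}\subseteq(0,1)$ be arbitrary, let $(P_n(x))_{n\in\mathbb{N}_0}$ be the random walk polynomial sequence with recurrence coefficients $(c_n)_{n\in\mathbb{N}}$, and let $(r_n)_{n\in\mathbb{N}_0}$, $(p_n)_{n\in\mathbb{N}_0}$, $(q_n)_{n\in\mathbb{N}_0}$ be the associated functions on $\{0,\ldots,\lfloor n/2\rfloor\}$ defined in the context. For $k\in\mathbb{N}$ let $(P_n(x;k))_{n\in\mathbb{N}_0}$ be the $k$-sieved random walk polynomial sequence corresponding to $(P_n(x))_{n\in\mathbb{N}_0}$. Then for every $k\in\mathbb{N}$, $n\in\mathbb{N}_0$ and $i\in\{0,\ldots,k-1\}$, one has $$P_{kn+i}(x;k)=\sum_{j=0}^{\lfloor\frac{n}{2}\rfloor}\left[p_n(j)T_{kn-2jk-i}(x)+q_n(j)T_{kn-2jk+i}(x)\right].$$ Moreover, one has $$r_n(j)=p_{n-1}(j-1)+q_{n-1}(j),\qquad n\in\mathbb{N},\ j\in\left\{0,\ldots,\left\lfloor\tfrac{n}{2}\right\rfloor\right\},$$ $$q_n(j)=r_n(j)-p_n(j),\qquad n\in\mathbb{N}_0,\ j\in\left\{0,\ldots,\left\lfloor\tfrac{n}{2}\right\rfloor\right\},$$ $$p_n(j)=\sum_{i=0}^{j}\left[r_n(i)-r_{n+1}(i)\right],\qquad n\in\mathbb{N}_0,\ j\in\left\{0,\ldots,\left\lfloor\tfrac{n}{2}\right\rfloor\right\}.$$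
   Context: $\mathbb{N}=\{1,2,\ldots\}$, $\mathbb{N}_0=\mathbb{N}\cup\{0\}$. Set $c_0:=0$ and $a_n:=1-c_n$ for $n\in\mathbb{N}_0$. Given $(c_n)_{n\in\mathbb{N}}\subseteq(0,1)$, the random walk polynomial sequence (RWPS) $(P_n(x))_{n\in\mathbb{N}_0}\subseteq\mathbb{R}[x]$ is given by $P_0(x)=1$ and $xP_n(x)=a_nP_{n+1}(x)+c_nP_{n-1}(x)$, $n\in\mathbb{N}_0$ (for $n=0$ the last term is $0$, so $P_1(x)=x$). For $k\in\mathbb{N}$, the $k$-sieved RWPS $(P_n(x;k))_{n\in\mathbb{N}_0}$ corresponding to $(P_n(x))_{n\in\mathbb{N}_0}$ is given by $P_0(x;k)=1$ and $xP_n(x;k)=a(n;k)P_{n+1}(x;k)+c(n;k)P_{n-1}(x;k)$, $n\in\mathbb{N}_0$, where $c(n;k):=c_{n/k}$ if $k\mid n$, $c(n;k):=\frac12$ otherwise, and $a(n;k):=1-c(n;k)$. $(T_n(x))_{n\in\mathbb{N}_0}$ are the Chebyshev polynomials of the first kind, $T_n(\cos\theta)=\cos(n\theta)$. For each $n\in\mathbb{N}_0$, $r_n\colon\{0,\ldots,\lfloor n/2\rfloor\}\to\mathbb{R}$ is defined by the expansion $P_n(x)=\sum_{j=0}^{\lfloor n/2\rfloor}r_n(j)T_{n-2j}(x)$. The functions $p_n,q_n\colon\{0,\ldots,\lfloor n/2\rfloor\}\to\mathbb{R}$, $n\in\mathbb{N}_0$, are defined recursively by $p_0(0):=0$, $q_0(0):=1$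 and, for $n\in\mathbb{N}$ and $j\in\{0,\ldots,\lfloor n/2\rfloor\}$, $$p_n(j):=\begin{cases}0,& n\text{ even and }j=\frac n2,\\ \dfrac{(2a_n-1)q_{n-1}(j)+p_{n-1}(j-1)}{2a_n},&\text{else},\end{cases}$$ $$q_n(j):=\begin{cases}p_{n-1}\left(\frac n2-1\right),& n\text{ even and }j=\frac n2,\\ \dfrac{q_{n-1}(j)+(2a_n-1)p_{n-1}(j-1)}{2a_n},&\text{else},\end{cases}$$ where $p_{n-1}(-1):=0$ for $n\in\mathbb{N}$. In addition one sets $q_{2n-1}(n):=0$ for $n\in\mathbb{N}$. Convention: $0$ times something undefined is $0$. In particular, the undefined expressions $T_{-(k-1)}(x),\ldots,T_{-1}(x)$ occur in the expansion only for even $n$, $j=n/2$, multiplied by $p_n(n/2)=0$, and such terms are interpreted as $0$. *)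

theory Defs
  imports Complex_Main "HOL-Computational_Algebra.Polynomial"
begin

section \<open>Chebyshev polynomials of the first kind\<close>

definition cheb_T :: "nat \<Rightarrow> real poly" where
  "cheb_T n = (THE p. \<forall>\<theta>::real. poly p (cos \<theta>) = cos (real n * \<theta>))"

lemma poly_eqI_cos:
  fixes p q :: "real poly"
  assumes "\<And>\<theta>::real. poly p (cos \<theta>) = poly q (cos \<theta>)"
  shows "p = q"
proof (rule ccontr)
  assume "p \<noteq> q"
  then have fin: "finite {x. poly (p - q) x = 0}"
    by (intro poly_roots_finite) simp
  have "{-1..1} \<subseteq> {x. poly (p - q) x = 0}"
  proof
    fix x :: real assume "x \<in> {-1..1}"
    then have "x = cos (arccos x)" by simp
    then show "x \<in> {x. poly (p - q) x = 0}"
      using assms[of "arccos x"] by simp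
  qed
  with fin have "finite {-1..1::real}" by (rule rev_finite_subset)
  moreover have "infinite {-1..1::real}" by (rule infinite_Icc) simp
  ultimately show False by blast
qed

lemma cheb_T_exists: "\<exists>p::real poly. \<forall>\<theta>. poly p (cos \<theta>) = cos (real n * \<theta>)"
proof (induction n rule: less_induct)
  case (less n)
  consider "n = 0" | "n = 1" | m where "n = Suc (Suc m)"
    by (metis One_nat_def not0_implies_Suc)
  then show ?case
  proof cases
    case 1
    then show ?thesis by (intro exI[of _ 1]) simp
  next
    case 2
    then show ?thesis by (intro exI[of _ "[:0, 1:]"]) simp
  next
    case 3
    obtain p where p: "\<And>\<theta>. poly p (cos \<theta>) = cos (real m * \<theta>)"
      using less[of m] 3 by auto
    obtain q where q: "\<And>\<theta>. poly q (cos \<theta>) = cos (real (Suc m) * \<theta>)"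
      using less[of "Suc m"] 3 by auto
    have "cos (real n * \<theta>) = 2 * cos \<theta> * cos (real (Suc m) * \<theta>) - cos (real m * \<theta>)" for \<theta>
    proof -
      have "cos (real n * \<theta>) = cos (real (Suc m) * \<theta> + \<theta>)"
        using 3 by (simp add: algebra_simps)
      moreover have "cos (real m * \<theta>) = cos (real (Suc m) * \<theta> - \<theta>)"
        by (simp add: algebra_simps)
      ultimately show ?thesis unfolding cos_add cos_diff by simp
    qed
    with p q show ?thesis
      by (intro exI[of _ "smult 2 (pCons 0 q) - p"]) simp
  qed
qed

lemma cheb_T_cos: "poly (cheb_T n) (cos \<theta>) = cos (real n * \<theta>)"
proof -
  have "\<exists>!p::real poly. \<forall>\<theta>. poly p (cos \<theta>) = cos (real n * \<theta>)"
    by (rule ex_ex1I[OF cheb_T_exists]) (auto intro: poly_eqI_cos)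
  from theI'[OF this] show ?thesis unfolding cheb_T_def by blast
qed

lemma cheb_T_0: "cheb_T 0 = 1"
  by (rule poly_eqI_cos) (simp add: cheb_T_cos)

lemma cheb_T_1: "cheb_T (Suc 0) = [:0, 1:]"
  by (rule poly_eqI_cos) (simp add: cheb_T_cos)

lemma cheb_T_Suc_Suc:
  "cheb_T (Suc (Suc n)) = smult 2 (pCons 0 (cheb_T (Suc n))) - cheb_T n"
proof (rule poly_eqI_cos)
  fix \<theta> :: real
  have "cos (real (Suc (Suc n)) * \<theta>) = cos (real (Suc n) * \<theta> + \<theta>)"
    by (simp add: algebra_simps)
  moreover have "cos (real n * \<theta>) = cos (real (Suc n) * \<theta> - \<theta>)"
    by (simp add: algebra_simps)
  ultimately show "poly (cheb_T (Suc (Suc n))) (cos \<theta>) =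
    poly (smult 2 (pCons 0 (cheb_T (Suc n))) - cheb_T n) (cos \<theta>)"
    unfolding poly_diff poly_smult poly_pCons cheb_T_cos cos_add cos_diff by simp
qed

lemma degree_cheb_T: "degree (cheb_T n) = n"
proof (induction n rule: less_induct)
  case (less n)
  consider "n = 0" | "n = 1" | m where "n = Suc (Suc m)"
    by (metis One_nat_def not0_implies_Suc)
  then show ?case
  proof cases
    case 3
    have dm: "degree (cheb_T m) = m" and ds: "degree (cheb_T (Suc m)) = Suc m"
      using less 3 by auto
    then have "cheb_T (Suc m) \<noteq> 0" by auto
    then have "degree (smult 2 (pCons 0 (cheb_T (Suc m)))) = Suc (Suc m)"
      using ds by simp
    then have "degree (smult 2 (pCons 0 (cheb_T (Suc m))) + - cheb_T m) = Suc (Suc m)"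
      using dm by (subst degree_add_eq_left) auto
    then show ?thesis using 3 by (simp add: cheb_T_Suc_Suc)
  qed (auto simp: cheb_T_0 cheb_T_1)
qed

section \<open>Random walk polynomials\<close>

text \<open>
  Throughout, \<open>c\<close> is a sequence with \<open>c 0 = 0\<close> and \<open>0 < c n < 1\<close> for \<open>n \<ge> 1\<close>. The recurrence
  \<open>x P\<^sub>n = a\<^sub>n P\<^sub>n\<^sub>+\<^sub>1 + c\<^sub>n P\<^sub>n\<^sub>-\<^sub>1\<close> is solved for \<open>P\<^sub>n\<^sub>+\<^sub>1\<close>; the original form is
  \<open>rwps_rec\<close> below.
\<close>

fun rwps :: "(nat \<Rightarrow> real) \<Rightarrow> nat \<Rightarrow> real poly" where
  "rwps c 0 = 1"
| "rwps c (Suc 0) = smult (1 / (1 - c 0)) [:0, 1:]"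
| "rwps c (Suc (Suc n)) =
     smult (1 / (1 - c (Suc n))) ([:0, 1:] * rwps c (Suc n) - smult (c (Suc n)) (rwps c n))"

lemma rwps_rec:
  assumes "c 0 = 0" and "\<And>n. n \<ge> 1 \<Longrightarrow> 0 < c n \<and> c n < 1"
  shows "[:0, 1:] * rwps c n = smult (1 - c n) (rwps c (n + 1)) + smult (c n) (rwps c (n - 1))"
proof (cases n)
  case 0
  then show ?thesis using assms(1) by simp
next
  case (Suc m)
  then have "c (Suc m) \<noteq> 1" using assms(2)[of "Suc m"] by simp
  then show ?thesis using Suc by simp
qed

definition sieve :: "nat \<Rightarrow> (nat \<Rightarrow> real) \<Rightarrow> nat \<Rightarrow> real" where
  "sieve k c n = (if k dvd n then c (n div k) else 1 / 2)"

definition sieved_rwps :: "nat \<Rightarrow> (nat \<Rightarrow> real) \<Rightarrow> nat \<Rightarrow> real poly" where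
  "sieved_rwps k c = rwps (sieve k c)"

lemma sieved_rwps_rec:
  assumes "c 0 = 0" and "\<And>n. n \<ge> 1 \<Longrightarrow> 0 < c n \<and> c n < 1" and "k \<ge> 1"
  shows "[:0, 1:] * sieved_rwps k c n =
    smult (1 - sieve k c n) (sieved_rwps k c (n + 1)) + smult (sieve k c n) (sieved_rwps k c (n - 1))"
  unfolding sieved_rwps_def
proof (rule rwps_rec)
  show "sieve k c 0 = 0" using assms(1) by (simp add: sieve_def)
  show "0 < sieve k c n \<and> sieve k c n < 1" if "n \<ge> 1" for n
  proof (cases "k dvd n")
    case True
    with that assms(3) have "n div k \<ge> 1"
      by (auto elim!: dvdE)
    with True show ?thesis using assms(2) by (simp add: sieve_def)
  qed (simp add: sieve_def)
qed

section \<open>Chebyshev coefficients\<close>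

text \<open>
  The coefficient functions \<open>r\<^sub>n\<close> live on \<open>{0..n div 2}\<close>; they are extended by \<open>0\<close>.
  Existence and uniqueness of the expansion is \<open>cheb_expansion_ex1\<close> below.
\<close>

definition cheb_coeff :: "(nat \<Rightarrow> real) \<Rightarrow> nat \<Rightarrow> nat \<Rightarrow> real" where
  "cheb_coeff c n = (THE r. (\<forall>j. j > n div 2 \<longrightarrow> r j = 0) \<and>
     rwps c n = (\<Sum>j = 0..n div 2. smult (r j) (cheb_T (n - 2 * j))))"

definition in_cheb_span :: "nat \<Rightarrow> real poly \<Rightarrow> bool" where
  "in_cheb_span n p \<longleftrightarrow> (\<exists>r. p = (\<Sum>j = 0..n div 2. smult (r j) (cheb_T (n - 2 * j))))"

lemma in_cheb_span_0: "in_cheb_span n 0"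
  unfolding in_cheb_span_def by (rule exI[of _ "\<lambda>_. 0"]) simp

lemma in_cheb_span_add: "in_cheb_span n p \<Longrightarrow> in_cheb_span n q \<Longrightarrow> in_cheb_span n (p + q)"
  unfolding in_cheb_span_def
proof (elim exE)
  fix r s
  assume "p = (\<Sum>j = 0..n div 2. smult (r j) (cheb_T (n - 2 * j)))"
    "q = (\<Sum>j = 0..n div 2. smult (s j) (cheb_T (n - 2 * j)))"
  then show "\<exists>r. p + q = (\<Sum>j = 0..n div 2. smult (r j) (cheb_T (n - 2 * j)))"
    by (intro exI[of _ "\<lambda>j. r j + s j"]) (simp add: smult_add_left sum.distrib)
qed

lemma in_cheb_span_smult: "in_cheb_span n p \<Longrightarrow> in_cheb_span n (smult b p)"
  unfolding in_cheb_span_def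
proof (elim exE)
  fix r
  assume "p = (\<Sum>j = 0..n div 2. smult (r j) (cheb_T (n - 2 * j)))"
  then show "\<exists>r. smult b p = (\<Sum>j = 0..n div 2. smult (r j) (cheb_T (n - 2 * j)))"
    by (intro exI[of _ "\<lambda>j. b * r j"]) (auto simp: poly_eq_iff coeff_sum sum_distrib_left mult.assoc)
qed

lemma in_cheb_span_sum:
  "finite A \<Longrightarrow> (\<And>j. j \<in> A \<Longrightarrow> in_cheb_span n (f j)) \<Longrightarrow> in_cheb_span n (\<Sum>j\<in>A. f j)"
  by (induction A rule: finite_induct) (auto intro: in_cheb_span_0 in_cheb_span_add)

lemma in_cheb_span_T:
  assumes "j \<le> n div 2"
  shows "in_cheb_span n (cheb_T (n - 2 * j))"
  unfolding in_cheb_span_def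
proof (rule exI[of _ "\<lambda>i. if i = j then 1 else 0"])
  have "(\<Sum>i = 0..n div 2. smult (if i = j then 1 else 0) (cheb_T (n - 2 * i)))
    = (\<Sum>i = 0..n div 2. if i = j then cheb_T (n - 2 * i) else 0)"
    by (intro sum.cong) auto
  also have "\<dots> = cheb_T (n - 2 * j)" using assms by simp
  finally show "cheb_T (n - 2 * j) =
    (\<Sum>i = 0..n div 2. smult (if i = j then 1 else 0) (cheb_T (n - 2 * i)))" by simp
qed

lemma in_cheb_span_Suc_Suc:
  assumes "in_cheb_span n p"
  shows "in_cheb_span (Suc (Suc n)) p"
proof -
  obtain r where "p = (\<Sum>j = 0..n div 2. smult (r j) (cheb_T (n - 2 * j)))"
    using assms unfolding in_cheb_span_def by blast
  moreover have "in_cheb_span (Suc (Suc n)) (cheb_T (n - 2 * j))" if "j \<le> n div 2" for j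
    using in_cheb_span_T[of "Suc j" "Suc (Suc n)"] that by simp
  ultimately show ?thesis by (auto intro!: in_cheb_span_sum in_cheb_span_smult)
qed

lemma in_cheb_span_x_mult:
  assumes "in_cheb_span n p"
  shows "in_cheb_span (Suc n) ([:0, 1:] * p)"
proof -
  obtain r where p: "p = (\<Sum>j = 0..n div 2. smult (r j) (cheb_T (n - 2 * j)))"
    using assms unfolding in_cheb_span_def by blast
  have *: "in_cheb_span (Suc n) ([:0, 1:] * cheb_T (n - 2 * j))" if j: "j \<le> n div 2" for j
  proof (cases "n - 2 * j")
    case 0
    have "Suc n - 2 * j = Suc 0" using 0 j by linarith
    moreover have "in_cheb_span (Suc n) (cheb_T (Suc n - 2 * j))"
      using j by (intro in_cheb_span_T) linarith
    ultimately show ?thesis using 0 by (simp add: cheb_T_0 cheb_T_1)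
  next
    case (Suc m)
    have e: "[:0, 1:] * cheb_T (n - 2 * j) =
        smult (1 / 2) (cheb_T (Suc (Suc m))) + smult (1 / 2) (cheb_T m)"
      using Suc by (simp add: cheb_T_Suc_Suc smult_diff_right)
    have "Suc (Suc m) = Suc n - 2 * j" using Suc by linarith
    moreover have "m = Suc n - 2 * Suc j" using Suc by simp
    moreover have "in_cheb_span (Suc n) (cheb_T (Suc n - 2 * j))"
      using j by (intro in_cheb_span_T) linarith
    moreover have "in_cheb_span (Suc n) (cheb_T (Suc n - 2 * Suc j))"
      using Suc by (intro in_cheb_span_T) linarith
    ultimately show ?thesis
      unfolding e by (metis in_cheb_span_add in_cheb_span_smult)
  qed
  have "[:0, 1:] * p = (\<Sum>j = 0..n div 2. smult (r j) ([:0, 1:] * cheb_T (n - 2 * j)))"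
    unfolding p sum_distrib_left by (intro sum.cong) auto
  then show ?thesis using * by (simp only:) (intro in_cheb_span_sum in_cheb_span_smult; simp)
qed

lemma in_cheb_span_rwps: "in_cheb_span n (rwps c n)"
proof (induction c n rule: rwps.induct)
  case (1 c)
  show ?case using in_cheb_span_T[of 0 0] by (simp add: cheb_T_0)
next
  case (2 c)
  show ?case using in_cheb_span_smult[OF in_cheb_span_T[of 0 "Suc 0"], of "1 / (1 - c 0)"]
    by (simp add: cheb_T_1)
next
  case (3 c n)
  have "in_cheb_span (Suc (Suc n)) ([:0, 1:] * rwps c (Suc n) + smult (- c (Suc n)) (rwps c n))"
    using 3 by (intro in_cheb_span_add in_cheb_span_x_mult in_cheb_span_smult in_cheb_span_Suc_Suc)
  from in_cheb_span_smult[OF this, of "1 / (1 - c (Suc n))"] show ?case by simp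
qed

lemma cheb_sum_eq_0:
  assumes "(\<Sum>j = 0..n div 2. smult (d j) (cheb_T (n - 2 * j))) = 0" and "j \<le> n div 2"
  shows "d j = 0"
  using assms(2)
proof (induction j rule: less_induct)
  case (less j)
  have "0 = coeff (\<Sum>i = 0..n div 2. smult (d i) (cheb_T (n - 2 * i))) (n - 2 * j)"
    using assms(1) by simp
  also have "\<dots> = (\<Sum>i = 0..n div 2. d i * coeff (cheb_T (n - 2 * i)) (n - 2 * j))"
    by (simp add: coeff_sum)
  also have "\<dots> = (\<Sum>i = 0..n div 2. if i = j then d j * coeff (cheb_T (n - 2 * j)) (n - 2 * j) else 0)"
  proof (rule sum.cong[OF refl])
    fix i assume i: "i \<in> {0..n div 2}"
    consider "i < j" | "i = j" | "i > j" by linarith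
    then show "d i * coeff (cheb_T (n - 2 * i)) (n - 2 * j) =
      (if i = j then d j * coeff (cheb_T (n - 2 * j)) (n - 2 * j) else 0)"
    proof cases
      case 1
      then show ?thesis using less by simp
    next
      case 3
      then have "n - 2 * i < n - 2 * j" using i by auto
      then show ?thesis using 3 by (simp add: coeff_eq_0 degree_cheb_T)
    qed simp
  qed
  also have "\<dots> = d j * coeff (cheb_T (n - 2 * j)) (n - 2 * j)"
    using less.prems by simp
  finally have "d j * lead_coeff (cheb_T (n - 2 * j)) = 0" by (simp add: degree_cheb_T)
  moreover have "cheb_T m \<noteq> 0" for m
    using degree_cheb_T[of m] by (cases m) (auto simp: cheb_T_0)
  ultimately show ?case by simp
qed

lemma cheb_expansion_ex1:
  "\<exists>!r. (\<forall>j. j > n div 2 \<longrightarrow> r j = 0) \<and>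
     rwps c n = (\<Sum>j = 0..n div 2. smult (r j) (cheb_T (n - 2 * j)))"
proof (rule ex_ex1I)
  obtain r where r: "rwps c n = (\<Sum>j = 0..n div 2. smult (r j) (cheb_T (n - 2 * j)))"
    using in_cheb_span_rwps[of n c] unfolding in_cheb_span_def by blast
  then show "\<exists>r. (\<forall>j. j > n div 2 \<longrightarrow> r j = 0) \<and>
     rwps c n = (\<Sum>j = 0..n div 2. smult (r j) (cheb_T (n - 2 * j)))"
    by (intro exI[of _ "\<lambda>j. if j \<le> n div 2 then r j else 0"]) simp
next
  fix r s
  assume r: "(\<forall>j. j > n div 2 \<longrightarrow> r j = 0) \<and>
      rwps c n = (\<Sum>j = 0..n div 2. smult (r j) (cheb_T (n - 2 * j)))"
    and s: "(\<forall>j. j > n div 2 \<longrightarrow> s j = 0) \<and>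
      rwps c n = (\<Sum>j = 0..n div 2. smult (s j) (cheb_T (n - 2 * j)))"
  then have "(\<Sum>j = 0..n div 2. smult (r j - s j) (cheb_T (n - 2 * j))) = 0"
    by (simp add: smult_diff_left sum_subtractf)
  from cheb_sum_eq_0[OF this] have "r j = s j" for j
    using r s by (cases "j \<le> n div 2") auto
  then show "r = s" by blast
qed

lemma cheb_coeff_expansion:
  "rwps c n = (\<Sum>j = 0..n div 2. smult (cheb_coeff c n j) (cheb_T (n - 2 * j)))"
  using theI'[OF cheb_expansion_ex1[of n c]] unfolding cheb_coeff_def by blast

section \<open>The functions \<open>p\<^sub>n\<close> and \<open>q\<^sub>n\<close>\<close>

text \<open>
  Both functions live on \<open>{0..n div 2}\<close> and are extended by \<open>0\<close>; in particular this gives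
  \<open>q\<^sub>2\<^sub>n\<^sub>-\<^sub>1(n) = 0\<close>. The recursion never reads any other value outside the domains, and
  \<open>p\<^sub>n\<^sub>-\<^sub>1(-1) = 0\<close> is written as a case distinction on \<open>j = 0\<close>.
\<close>

fun sieve_p :: "(nat \<Rightarrow> real) \<Rightarrow> nat \<Rightarrow> nat \<Rightarrow> real"
  and sieve_q :: "(nat \<Rightarrow> real) \<Rightarrow> nat \<Rightarrow> nat \<Rightarrow> real" where
  "sieve_p c 0 j = 0"
| "sieve_p c (Suc m) j =
    (if j > Suc m div 2 then 0
     else if even (Suc m) \<and> j = Suc m div 2 then 0
     else let a = 1 - c (Suc m); p' = (if j = 0 then 0 else sieve_p c m (j - 1))
          in ((2 * a - 1) * sieve_q c m j + p') / (2 * a))"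
| "sieve_q c 0 j = (if j = 0 then 1 else 0)"
| "sieve_q c (Suc m) j =
    (if j > Suc m div 2 then 0
     else if even (Suc m) \<and> j = Suc m div 2 then sieve_p c m (Suc m div 2 - 1)
     else let a = 1 - c (Suc m); p' = (if j = 0 then 0 else sieve_p c m (j - 1))
          in (sieve_q c m j + (2 * a - 1) * p') / (2 * a))"

text \<open>
  In expressions \<open>smult (sieve_p c n j) (cheb_T (k * n - 2 * j * k - i))\<close> with \<open>j \<le> n div 2\<close> and
  \<open>i < k\<close>, the subtraction on \<open>nat\<close> truncates only if \<open>n\<close> is even, \<open>j = n div 2\<close> and \<open>i > 0\<close>.
  These are the terms whose Chebyshev index would be negative, and they vanish by the following lemma.
\<close>

lemma sieve_p_half: "even n \<Longrightarrow> sieve_p c n (n div 2) = 0"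
  by (cases n) auto

end

theory Submission
  imports Defs
begin

text \<open>
  Write \<open>x = cos \<theta>\<close>, so that \<open>T\<^sub>m(x) = cos (m \<theta>)\<close> makes sense for every integer \<open>m\<close>, and let
  \<open>F\<^sub>n(i)\<close> be the claimed value of \<open>P\<^bsub>kn+i\<^esub>(x;k)\<close>. Inside a block \<open>kn < kn+i < kn+k\<close> the sieved
  recurrence is the Chebyshev recurrence \<open>2 x y\<^sub>m = y\<^sub>m\<^sub>+\<^sub>1 + y\<^sub>m\<^sub>-\<^sub>1\<close>. For fixed coefficients,
  \<open>cos ((N - i) \<theta>)\<close> and \<open>cos ((N + i) \<theta>)\<close> both solve it in \<open>i\<close>, and hence so does \<open>F\<^sub>n\<close>.
  What has to be proved is that the blocks are glued correctly at the multiples of \<open>k\<close>, and the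
  recursion for \<open>p\<^sub>n\<close> and \<open>q\<^sub>n\<close> is made for exactly this:

  \<^item> \<open>p\<^sub>n(j) + q\<^sub>n(j) = p\<^sub>n\<^sub>-\<^sub>1(j-1) + q\<^sub>n\<^sub>-\<^sub>1(j)\<close> says that the last value \<open>F\<^sub>n\<^sub>-\<^sub>1(k)\<close> obtained by continuing
    one block is the first value \<open>F\<^sub>n(0)\<close> of the next (\<open>block_glue\<close>);
  \<^item> solving the same two equations differently shows that the recurrence at the index \<open>kn\<close>, with
    the coefficients \<open>a\<^sub>n\<close> and \<open>c\<^sub>n\<close>, links \<open>F\<^sub>n\<^sub>-\<^sub>1(k-1)\<close>, \<open>F\<^sub>n(0)\<close> and \<open>F\<^sub>n(1)\<close>
    (\<open>block_boundary\<close>).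

  Allowing the closing value \<open>i = k\<close> in the induction treats \<open>k = 1\<close> and \<open>k \<ge> 2\<close> alike. The relations
  with \<open>r\<^sub>n\<close> then come from \<open>k = 1\<close>, where the sieved polynomials are the original ones: the expansion
  reads \<open>P\<^sub>n = \<Sum>\<^sub>j (p\<^sub>n(j) + q\<^sub>n(j)) T\<^bsub>n-2j\<^esub>\<close>, so \<open>r\<^sub>n = p\<^sub>n + q\<^sub>n\<close> by uniqueness of Chebyshev expansions,
  and the sum formula for \<open>p\<^sub>n\<close> telescopes.
\<close>

section \<open>The recursion for the coefficient functions\<close>

definition lag :: "(nat \<Rightarrow> real) \<Rightarrow> nat \<Rightarrow> real" where
  "lag f j = (if j = 0 then 0 else f (j - 1))"

lemma sieve_p_eq_0:
  assumes "n \<le> 2 * j"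
  shows "sieve_p c n j = 0"
proof (cases n)
  case (Suc m)
  then have "j > Suc m div 2 \<or> even (Suc m) \<and> j = Suc m div 2" using assms by presburger
  then show ?thesis unfolding Suc sieve_p.simps by auto
qed simp

lemma sieve_q_eq_0: "n < 2 * j \<Longrightarrow> sieve_q c n j = 0"
  by (cases n) auto

lemma sieve_p_q_Suc:
  assumes "2 * j < Suc m"
  shows "sieve_p c (Suc m) j
      = ((1 - 2 * c (Suc m)) * sieve_q c m j + lag (sieve_p c m) j) / (2 * (1 - c (Suc m)))"
    and "sieve_q c (Suc m) j
      = (sieve_q c m j + (1 - 2 * c (Suc m)) * lag (sieve_p c m) j) / (2 * (1 - c (Suc m)))"
proof -
  have "\<not> j > Suc m div 2" "\<not> (even (Suc m) \<and> j = Suc m div 2)" using assms by presburger+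
  note * = this[THEN if_not_P]
  have a: "2 * (1 - c (Suc m)) - 1 = 1 - 2 * c (Suc m)" by simp
  show
    "sieve_p c (Suc m) j
      = ((1 - 2 * c (Suc m)) * sieve_q c m j + lag (sieve_p c m) j) / (2 * (1 - c (Suc m)))"
    "sieve_q c (Suc m) j
      = (sieve_q c m j + (1 - 2 * c (Suc m)) * lag (sieve_p c m) j) / (2 * (1 - c (Suc m)))"
    by (simp_all only: sieve_p.simps sieve_q.simps * Let_def lag_def a)
qed

text \<open>
  In the sum of the two defining equations both \<open>q\<^sub>n\<^sub>-\<^sub>1(j)\<close> and \<open>p\<^sub>n\<^sub>-\<^sub>1(j-1)\<close> get the factor
  \<open>(2a\<^sub>n - 1) + 1 = 2a\<^sub>n\<close>, which cancels the denominator. The special values at the middle index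
  \<open>n = 2j\<close> keep the identity alive there, where \<open>q\<^sub>n\<close> alone has to carry the sum, and the extension
  by \<open>0\<close> makes it hold beyond the middle.
\<close>

lemma sieve_p_plus_q_Suc:
  assumes "c (Suc m) < 1"
  shows "sieve_p c (Suc m) j + sieve_q c (Suc m) j = lag (sieve_p c m) j + sieve_q c m j"
proof -
  consider "2 * j > Suc m" | "2 * j = Suc m" | "2 * j < Suc m" by linarith
  then show ?thesis
  proof cases
    case 1
    then show ?thesis by (simp add: lag_def sieve_p_eq_0 sieve_q_eq_0)
  next
    case 2
    then have "even (Suc m)" "j = Suc m div 2" by presburger+
    with 2 show ?thesis by (simp add: lag_def sieve_q_eq_0)
  next
    case 3
    show ?thesis unfolding sieve_p_q_Suc[OF 3] add_divide_distrib[symmetric]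
      using assms by (simp add: divide_eq_eq) algebra
  qed
qed

text \<open>
  The coefficient comparison behind \<open>x F\<^sub>n(0) = a\<^sub>n F\<^sub>n(1) + c\<^sub>n F\<^sub>n\<^sub>-\<^sub>1(k-1)\<close>: with \<open>N = k (n - 2j)\<close>, the
  first identity compares the coefficients of frequency \<open>N - 1\<close>, the second those of frequency
  \<open>N + 1\<close>. The factor \<open>1/2\<close> comes from \<open>2 cos \<theta> cos (N \<theta>) = cos ((N - 1) \<theta>) + cos ((N + 1) \<theta>)\<close>.
\<close>

lemma sieve_p_q_Suc_below_middle:
  assumes "c (Suc m) < 1" "2 * j < Suc m"
  shows "(1 - c (Suc m)) * sieve_p c (Suc m) j + c (Suc m) * sieve_q c m j
      = (sieve_p c (Suc m) j + sieve_q c (Suc m) j) / 2"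
    and "(1 - c (Suc m)) * sieve_q c (Suc m) j + c (Suc m) * lag (sieve_p c m) j
      = (sieve_p c (Suc m) j + sieve_q c (Suc m) j) / 2"
proof -
  have a: "1 - c (Suc m) \<noteq> 0" using assms(1) by simp
  have s: "(sieve_p c (Suc m) j + sieve_q c (Suc m) j) / 2 = (lag (sieve_p c m) j + sieve_q c m j) / 2"
    using sieve_p_plus_q_Suc[of c m j] assms(1) by simp
  show
    "(1 - c (Suc m)) * sieve_p c (Suc m) j + c (Suc m) * sieve_q c m j
      = (sieve_p c (Suc m) j + sieve_q c (Suc m) j) / 2"
    "(1 - c (Suc m)) * sieve_q c (Suc m) j + c (Suc m) * lag (sieve_p c m) j
      = (sieve_p c (Suc m) j + sieve_q c (Suc m) j) / 2"
    unfolding s unfolding sieve_p_q_Suc[OF assms(2)] using a by (simp_all add: field_simps)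
qed

text \<open>
  At the middle index \<open>n = 2j\<close> the two identities above need not hold separately, but the
  frequencies \<open>N \<plusminus> 1\<close> they belong to are then \<open>\<plusminus> 1\<close>, which give the same cosine, and only the sum
  of the coefficients matters.
\<close>

lemma boundary_term:
  fixes N \<theta> :: real
  assumes "c (Suc m) < 1" "2 * j \<le> Suc m" "2 * j = Suc m \<Longrightarrow> N = 0"
  shows "cos \<theta> * ((sieve_p c (Suc m) j + sieve_q c (Suc m) j) * cos (N * \<theta>))
    = (1 - c (Suc m)) * (sieve_p c (Suc m) j * cos ((N - 1) * \<theta>)
        + sieve_q c (Suc m) j * cos ((N + 1) * \<theta>))
    + c (Suc m) * (lag (sieve_p c m) j * cos ((N + 1) * \<theta>) + sieve_q c m j * cos ((N - 1) * \<theta>))"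
    (is "_ = ?R")
proof (cases "2 * j = Suc m")
  case True
  then have "N = 0" "sieve_p c (Suc m) j = 0" "sieve_q c m j = 0"
    using assms(3) by (simp_all add: sieve_p_eq_0 sieve_q_eq_0)
  moreover from this sieve_p_plus_q_Suc[of c m j] assms(1)
  have "sieve_q c (Suc m) j = lag (sieve_p c m) j" by simp
  ultimately show ?thesis by (simp add: algebra_simps)
next
  case False
  let ?s = "sieve_p c (Suc m) j + sieve_q c (Suc m) j"
  have "2 * j < Suc m" using False assms(2) by simp
  note e = sieve_p_q_Suc_below_middle[of c m j, OF assms(1) this]
  have "?R = ((1 - c (Suc m)) * sieve_p c (Suc m) j + c (Suc m) * sieve_q c m j) * cos ((N - 1) * \<theta>)
    + ((1 - c (Suc m)) * sieve_q c (Suc m) j + c (Suc m) * lag (sieve_p c m) j) * cos ((N + 1) * \<theta>)"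
    by (simp only: algebra_simps)
  also have "\<dots> = ?s / 2 * (cos ((N - 1) * \<theta>) + cos ((N + 1) * \<theta>))"
    unfolding e by (simp only: algebra_simps)
  also have "cos ((N - 1) * \<theta>) + cos ((N + 1) * \<theta>) = 2 * (cos \<theta> * cos (N * \<theta>))"
    by (simp add: algebra_simps cos_add cos_diff)
  finally show ?thesis by simp
qed

section \<open>Blocks of the expansion\<close>

text \<open>
  The claimed expansion at \<open>cos \<theta>\<close>, with frequencies computed in the reals: a negative frequency
  is harmless since the cosine is even, which keeps the truncated subtraction on \<open>nat\<close> out of
  the calculations.
\<close>

definition block :: "(nat \<Rightarrow> real) \<Rightarrow> nat \<Rightarrow> nat \<Rightarrow> real \<Rightarrow> real \<Rightarrow> real" where
  "block c k n \<theta> i = (\<Sum>j = 0..n div 2.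
     sieve_p c n j * cos ((real k * (real n - 2 * real j) - i) * \<theta>)
   + sieve_q c n j * cos ((real k * (real n - 2 * real j) + i) * \<theta>))"

text \<open>
  Each summand satisfies the recurrence in \<open>i\<close>, since \<open>cos (y + \<theta>) + cos (y - \<theta>) = 2 cos \<theta> cos y\<close>.
\<close>

lemma block_recurrence:
  "block c k n \<theta> (i + 1) = 2 * cos \<theta> * block c k n \<theta> i - block c k n \<theta> (i - 1)"
proof -
  have shift: "cos ((N - (i + 1)) * \<theta>) = 2 * cos \<theta> * cos ((N - i) * \<theta>) - cos ((N - (i - 1)) * \<theta>)"
    "cos ((N + (i + 1)) * \<theta>) = 2 * cos \<theta> * cos ((N + i) * \<theta>) - cos ((N + (i - 1)) * \<theta>)" for N
  proof -
    have "cos (y - \<theta>) = 2 * cos \<theta> * cos y - cos (y + \<theta>)"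
      "cos (y + \<theta>) = 2 * cos \<theta> * cos y - cos (y - \<theta>)" for y
      by (simp_all add: cos_add cos_diff)
    from this(1)[of "(N - i) * \<theta>"] this(2)[of "(N + i) * \<theta>"]
    show "cos ((N - (i + 1)) * \<theta>) = 2 * cos \<theta> * cos ((N - i) * \<theta>) - cos ((N - (i - 1)) * \<theta>)"
      "cos ((N + (i + 1)) * \<theta>) = 2 * cos \<theta> * cos ((N + i) * \<theta>) - cos ((N + (i - 1)) * \<theta>)"
      by (simp_all add: algebra_simps)
  qed
  show ?thesis
    unfolding block_def sum_distrib_left sum_subtractf[symmetric] shift
    by (intro sum.cong refl) (simp only: algebra_simps)
qed

text \<open>
  Neighbouring blocks can be compared termwise only if they use the same frequencies. Since
  \<open>k (m - 2j) - (k - i) = k (m + 1 - 2(j + 1)) + i\<close> and \<open>k (m - 2j) + (k - i) = k (m + 1 - 2j) - i\<close>,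
  block \<open>m\<close> counted backwards from its end has the frequencies of block \<open>m + 1\<close>, once the index
  of its \<open>p\<close>-part is shifted by one. The vanishing of \<open>p\<^sub>m\<close> and \<open>q\<^sub>m\<close> outside their domains and of
  \<open>p\<^sub>m(m/2)\<close> lets the two summation ranges agree.
\<close>

lemma block_from_end:
  "block c k m \<theta> (real k - i) = (\<Sum>j = 0..Suc m div 2.
     lag (sieve_p c m) j * cos ((real k * (real (Suc m) - 2 * real j) + i) * \<theta>)
   + sieve_q c m j * cos ((real k * (real (Suc m) - 2 * real j) - i) * \<theta>))"
proof -
  let ?M = "Suc m div 2"
  let ?g = "\<lambda>j. cos ((real k * (real (Suc m) - 2 * real j) + i) * \<theta>)"
  let ?h = "\<lambda>j. cos ((real k * (real (Suc m) - 2 * real j) - i) * \<theta>)"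
  have "(\<Sum>j = 0..m div 2. sieve_p c m j * ?g (Suc j)) = (\<Sum>j = 0..<?M. sieve_p c m j * ?g (Suc j))"
    by (rule sum.mono_neutral_right) (auto intro!: sieve_p_eq_0)
  also have "\<dots> = (\<Sum>j = 0..?M. lag (sieve_p c m) j * ?g j)"
    unfolding atLeastLessThanSuc_atLeastAtMost[symmetric] sum.atLeast0_lessThan_Suc_shift
    by (simp add: lag_def)
  finally have p: "(\<Sum>j = 0..m div 2. sieve_p c m j * ?g (Suc j))
    = (\<Sum>j = 0..?M. lag (sieve_p c m) j * ?g j)" .
  have q: "(\<Sum>j = 0..m div 2. sieve_q c m j * ?h j) = (\<Sum>j = 0..?M. sieve_q c m j * ?h j)"
    by (rule sum.mono_neutral_left) (auto intro!: sieve_q_eq_0)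
  show ?thesis
    unfolding sum.distrib p[symmetric] q[symmetric] block_def
    by (intro arg_cong2[where f = "(+)"] sum.cong refl arg_cong2[where f = "(*)"] arg_cong[where f = cos])
       (simp_all add: algebra_simps)
qed

lemma block_glue:
  assumes "c (Suc m) < 1"
  shows "block c k m \<theta> (real k) = block c k (Suc m) \<theta> 0"
  using block_from_end[of c k m \<theta> 0] sieve_p_plus_q_Suc[of c m, OF assms, symmetric]
  by (simp add: block_def distrib_right[symmetric] del: sieve_p.simps sieve_q.simps)

lemma block_boundary:
  assumes "c (Suc m) < 1"
  shows "cos \<theta> * block c k (Suc m) \<theta> 0
    = (1 - c (Suc m)) * block c k (Suc m) \<theta> 1 + c (Suc m) * block c k m \<theta> (real k - 1)"
proof -
  have "cos \<theta> * block c k (Suc m) \<theta> 0 = (\<Sum>j = 0..Suc m div 2. cos \<theta> *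
      ((sieve_p c (Suc m) j + sieve_q c (Suc m) j) * cos (real k * (real (Suc m) - 2 * real j) * \<theta>)))"
    by (simp add: block_def sum_distrib_left distrib_right del: sieve_p.simps sieve_q.simps)
  also have "\<dots> = (1 - c (Suc m)) * block c k (Suc m) \<theta> 1 + c (Suc m) * block c k m \<theta> (real k - 1)"
    unfolding block_from_end unfolding block_def sum_distrib_left sum.distrib[symmetric]
  proof (intro sum.cong refl boundary_term assms)
    fix j assume "j \<in> {0..Suc m div 2}"
    then show "2 * j \<le> Suc m" by auto
    assume "2 * j = Suc m"
    then have "real (Suc m) = 2 * real j" by linarith
    then show "real k * (real (Suc m) - 2 * real j) = 0" by simp
  qed
  finally show ?thesis .
qed

section \<open>The expansion of the sieved polynomials\<close>

text \<open>
  The induction over the blocks: by gluing and the boundary relation, a block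
  determines the first two values of the next one, and the inner recurrence fills in the rest. The range
  includes \<open>i = k\<close> because that value is where the next block starts.
\<close>

lemma sieved_rwps_eq_block:
  assumes "c 0 = 0" and range: "\<And>n. n \<ge> 1 \<Longrightarrow> 0 < c n \<and> c n < 1" and "k \<ge> 1" "i \<le> k"
  shows "poly (sieved_rwps k c (k * n + i)) (cos \<theta>) = block c k n \<theta> (real i)"
proof -
  let ?P = "\<lambda>m. poly (sieved_rwps k c m) (cos \<theta>)"
  have rec: "cos \<theta> * ?P m = (1 - sieve k c m) * ?P (m + 1) + sieve k c m * ?P (m - 1)" for m
    using arg_cong[OF sieved_rwps_rec[of c k m, OF assms(1-3)], of "\<lambda>p. poly p (cos \<theta>)"] by simp
  \<comment> \<open>Two initial values determine a whole block, as all coefficients strictly inside it are \<open>1/2\<close>.\<close>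
  have fill: "?P (k * n + i) = block c k n \<theta> (real i)"
    if "?P (k * n) = block c k n \<theta> 0" "?P (k * n + 1) = block c k n \<theta> 1" "i \<le> k" for n i
    using that(3)
  proof (induction i rule: less_induct)
    case (less i)
    consider "i = 0" | "i = 1" | l where "i = Suc (Suc l)"
      by (metis One_nat_def not0_implies_Suc)
    then show ?case
    proof cases
      case 3
      have "\<not> k dvd k * n + Suc l"
        using less.prems 3 by (auto simp del: add_Suc_right simp: dvd_add_right_iff dest!: dvd_imp_le)
      with rec[of "k * n + Suc l"]
      have "?P (k * n + i) = 2 * cos \<theta> * ?P (k * n + Suc l) - ?P (k * n + l)"
        using 3 by (simp add: sieve_def)
      also have "\<dots> = block c k n \<theta> (real i)"
        using block_recurrence[of c k n \<theta> "real (Suc l)"] less.IH[of "Suc l"] less.IH[of l]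
          less.prems 3 by (simp add: add.commute)
      finally show ?thesis .
    qed (use that in simp_all)
  qed
  show ?thesis
    using \<open>i \<le> k\<close>
  proof (induction n arbitrary: i)
    case 0
    show ?case
    proof (rule fill[OF _ _ 0])
      have "?P 0 = 1" by (simp add: sieved_rwps_def)
      moreover from this rec[of 0] have "?P 1 = cos \<theta>"
        using assms(1) by (simp add: sieve_def)
      ultimately show "?P (k * 0) = block c k 0 \<theta> 0" "?P (k * 0 + 1) = block c k 0 \<theta> 1"
        by (simp_all add: block_def)
    qed
  next
    case (Suc m)
    have c: "c (Suc m) < 1" using range[of "Suc m"] by simp
    have start: "?P (k * Suc m) = block c k (Suc m) \<theta> 0"
      using Suc.IH[of k] block_glue[of c m k \<theta>, OF c] by (simp add: add.commute)
    have idx: "k * Suc m - 1 = k * m + (k - 1)" using \<open>k \<ge> 1\<close> by simp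
    have "sieve k c (k * Suc m) = c (Suc m)"
      unfolding sieve_def using \<open>k \<ge> 1\<close> by (simp del: mult_Suc_right)
    with rec[of "k * Suc m"] start Suc.IH[of "k - 1"] \<open>k \<ge> 1\<close>
    have "cos \<theta> * block c k (Suc m) \<theta> 0
      = (1 - c (Suc m)) * ?P (k * Suc m + 1) + c (Suc m) * block c k m \<theta> (real k - 1)"
      unfolding idx by (simp add: of_nat_diff del: mult_Suc_right)
    with block_boundary[of c m \<theta> k, OF c] c
    have "?P (k * Suc m + 1) = block c k (Suc m) \<theta> 1" by simp
    with start Suc.prems show ?case by (intro fill)
  qed
qed

text \<open>
  The only frequency that can become negative, hence be altered by truncated subtraction, is \<open>-i\<close>
  at \<open>n = 2j\<close>, and it is multiplied by \<open>p\<^sub>n(n/2) = 0\<close>.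
\<close>

lemma sieved_rwps_expansion:
  assumes "c 0 = 0" "\<And>n. n \<ge> 1 \<Longrightarrow> 0 < c n \<and> c n < 1" "k \<ge> 1" "i < k"
  shows "sieved_rwps k c (k * n + i) = (\<Sum>j = 0..n div 2.
     smult (sieve_p c n j) (cheb_T (k * n - 2 * j * k - i))
   + smult (sieve_q c n j) (cheb_T (k * n - 2 * j * k + i)))"
proof (rule poly_eqI_cos)
  fix \<theta> :: real
  have "block c k n \<theta> (real i) = (\<Sum>j = 0..n div 2.
      sieve_p c n j * cos (real (k * n - 2 * j * k - i) * \<theta>)
    + sieve_q c n j * cos (real (k * n - 2 * j * k + i) * \<theta>))"
    unfolding block_def
  proof (rule sum.cong[OF refl])
    fix j assume "j \<in> {0..n div 2}"
    then have j: "2 * j \<le> n" by auto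
    have kn: "k * n - 2 * j * k = k * (n - 2 * j)"
      by (simp add: right_diff_distrib' algebra_simps)
    have q: "real k * (real n - 2 * real j) + real i = real (k * n - 2 * j * k + i)"
      unfolding kn using j by (simp add: of_nat_diff)
    have p: "sieve_p c n j = 0
      \<or> real k * (real n - 2 * real j) - real i = real (k * n - 2 * j * k - i)"
    proof (cases "n = 2 * j")
      case False
      with j have "k * 1 \<le> k * (n - 2 * j)" by (intro mult_le_mono2) simp
      with \<open>i < k\<close> have "i \<le> k * (n - 2 * j)" by linarith
      with j show ?thesis unfolding kn by (simp add: of_nat_diff)
    qed (simp add: sieve_p_eq_0)
    show "sieve_p c n j * cos ((real k * (real n - 2 * real j) - real i) * \<theta>)
        + sieve_q c n j * cos ((real k * (real n - 2 * real j) + real i) * \<theta>)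
      = sieve_p c n j * cos (real (k * n - 2 * j * k - i) * \<theta>)
        + sieve_q c n j * cos (real (k * n - 2 * j * k + i) * \<theta>)"
      using p unfolding q by auto
  qed
  with sieved_rwps_eq_block[where c = c, OF assms(1-3) less_imp_le[OF assms(4)], of n \<theta>]
  show "poly (sieved_rwps k c (k * n + i)) (cos \<theta>) = poly (\<Sum>j = 0..n div 2.
     smult (sieve_p c n j) (cheb_T (k * n - 2 * j * k - i))
   + smult (sieve_q c n j) (cheb_T (k * n - 2 * j * k + i))) (cos \<theta>)"
    by (simp add: poly_sum cheb_T_cos)
qed

section \<open>Relation with the Chebyshev coefficients\<close>

lemma cheb_coeff_eqI:
  assumes "\<And>j. j > n div 2 \<Longrightarrow> r j = 0"
    and "rwps c n = (\<Sum>j = 0..n div 2. smult (r j) (cheb_T (n - 2 * j)))"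
  shows "cheb_coeff c n = r"
  unfolding cheb_coeff_def by (rule the1_equality[OF cheb_expansion_ex1]) (use assms in auto)

text \<open>
  For \<open>k = 1\<close> sieving changes nothing, and at \<open>i = 0\<close> the two Chebyshev polynomials with index \<open>j\<close>
  in the expansion coincide.
\<close>

lemma cheb_coeff_eq_p_plus_q:
  assumes "c 0 = 0" "\<And>n. n \<ge> 1 \<Longrightarrow> 0 < c n \<and> c n < 1"
  shows "cheb_coeff c n j = sieve_p c n j + sieve_q c n j"
proof -
  have "sieve 1 c = c" by (simp add: sieve_def fun_eq_iff)
  then have "rwps c n = sieved_rwps 1 c (1 * n + 0)" by (simp add: sieved_rwps_def)
  also have "\<dots> = (\<Sum>j = 0..n div 2. smult (sieve_p c n j + sieve_q c n j) (cheb_T (n - 2 * j)))"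
    by (subst sieved_rwps_expansion[where c = c, OF assms]) (simp_all add: smult_add_left)
  finally have "cheb_coeff c n = (\<lambda>j. sieve_p c n j + sieve_q c n j)"
    by (intro cheb_coeff_eqI) (simp_all add: sieve_p_eq_0 sieve_q_eq_0 div_less_iff_less_mult)
  then show ?thesis by simp
qed

theorem theorem2p1:
  fixes c :: "nat \<Rightarrow> real"
  assumes c0: "c 0 = 0"
    and c_range: "\<And>n. n \<ge> 1 \<Longrightarrow> 0 < c n \<and> c n < 1"
  shows
    "(\<forall>k\<ge>1. \<forall>n. \<forall>i\<in>{0..k - 1}.
        sieved_rwps k c (k * n + i) =
          (\<Sum>j = 0..n div 2.
             smult (sieve_p c n j) (cheb_T (k * n - 2 * j * k - i))
           + smult (sieve_q c n j) (cheb_T (k * n - 2 * j * k + i)))) \<and>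
     (\<forall>n\<ge>1. \<forall>j\<in>{0..n div 2}.
        cheb_coeff c n j =
          (if j = 0 then 0 else sieve_p c (n - 1) (j - 1)) + sieve_q c (n - 1) j) \<and>
     (\<forall>n. \<forall>j\<in>{0..n div 2}. sieve_q c n j = cheb_coeff c n j - sieve_p c n j) \<and>
     (\<forall>n. \<forall>j\<in>{0..n div 2}.
        sieve_p c n j = (\<Sum>i = 0..j. cheb_coeff c n i - cheb_coeff c (n + 1) i))"
proof -
  note r_eq = cheb_coeff_eq_p_plus_q[where c = c, OF assms]
  have r_Suc: "cheb_coeff c (Suc m) j = lag (sieve_p c m) j + sieve_q c m j" for m j
    using r_eq[of "Suc m" j] sieve_p_plus_q_Suc[of c m j] c_range[of "Suc m"] by simp
  have expansion: "\<forall>k\<ge>1. \<forall>n. \<forall>i\<in>{0..k - 1}.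
        sieved_rwps k c (k * n + i) =
          (\<Sum>j = 0..n div 2.
             smult (sieve_p c n j) (cheb_T (k * n - 2 * j * k - i))
           + smult (sieve_q c n j) (cheb_T (k * n - 2 * j * k + i)))"
    by (intro allI impI ballI sieved_rwps_expansion[where c = c, OF assms]) auto
  have r_rec: "cheb_coeff c n j =
      (if j = 0 then 0 else sieve_p c (n - 1) (j - 1)) + sieve_q c (n - 1) j" if "n \<ge> 1" for n j
    using r_Suc[of "n - 1" j] that by (simp add: lag_def)
  have telescope: "sieve_p c n j = (\<Sum>i = 0..j. cheb_coeff c n i - cheb_coeff c (n + 1) i)" for n j
  proof -
    have "(\<Sum>i = 0..j. cheb_coeff c n i - cheb_coeff c (n + 1) i)
      = (\<Sum>i = 0..j. sieve_p c n i - lag (sieve_p c n) i)"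
      by (simp add: r_eq[of n] r_Suc)
    also have "\<dots> = sieve_p c n j" by (induction j) (simp_all add: lag_def)
    finally show ?thesis by simp
  qed
  have q_eq: "sieve_q c n j = cheb_coeff c n j - sieve_p c n j" for n j
    by (simp add: r_eq)
  show ?thesis
    by (intro conjI expansion) (use r_rec q_eq telescope in blast)+
qed

end
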